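(* Let $A$ be a unital $C^*$-algebra. Let $V$ be a countably generated Hilbert $A$-module for which the topologies $\tau_{\widehat V}$ and $\tau_{V'}$ coincide. Then $V$ is self-dual.
   Context: Hilbert modules are right Hilbert $C^*$-modules, with $A$-valued inner product $\langle\cdot,\cdot\rangle$ that is $A$-linear in the second variable and norm $\|x\|=\|\langle x,x\rangle\|^{1/2}$. A Hilbert $A$-module $V$ is countably generated if there is a sequence in $V$ whose finite $A$-linear combinations are norm-dense in $V$. $V'$ denotes the set of all bounded $A$-linear maps $V\to A$. $V$ is called self-dual if every $f\in V'$ is of the form $f=\langle x,\cdot\rangle$ for some $x\in V$. The topology $\tau_{V'}$ on $V$ is the locally convex topology generated by the seminorms $\nu_f(x)=\|f(x)\|$, $f\in V'$; the topology $\tau_{\widehat V}$ on $V$ is the locally convex topology generated by the seminorms $\mu_z(x)=\|\langle z,x\rangle\|$, $z\in V$. *)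

theory Defs
  imports "HOL-Analysis.Analysis"
begin

section \<open>Unital C*-algebras\<close>

class complex_vector = real_vector +
  fixes scaleC :: "complex \<Rightarrow> 'a \<Rightarrow> 'a" (infixr \<open>*\<^sub>C\<close> 75)
  assumes scaleC_add_right: "c *\<^sub>C (x + y) = c *\<^sub>C x + c *\<^sub>C y"
    and scaleC_add_left: "(c + d) *\<^sub>C x = c *\<^sub>C x + d *\<^sub>C x"
    and scaleC_scaleC: "c *\<^sub>C (d *\<^sub>C x) = (c * d) *\<^sub>C x"
    and scaleC_one: "1 *\<^sub>C x = x"
    and scaleR_scaleC: "r *\<^sub>R x = complex_of_real r *\<^sub>C x"

text \<open>The unit comes from \<^class>\<open>monoid_mult\<close> rather than from \<^class>\<open>real_normed_algebra_1\<close>,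
  so that the zero algebra is not excluded. For a nonzero algebra, \<open>norm 1 = 1\<close> follows from the
  C*-identity.\<close>

class unital_cstar_algebra = complex_vector + real_normed_algebra + banach + monoid_mult +
  fixes star :: "'a \<Rightarrow> 'a"
  assumes mult_scaleC_left: "(c *\<^sub>C x) * y = c *\<^sub>C (x * y)"
    and mult_scaleC_right: "x * (c *\<^sub>C y) = c *\<^sub>C (x * y)"
    and norm_scaleC: "norm (c *\<^sub>C x) = cmod c * norm x"
    and star_star: "star (star x) = x"
    and star_add: "star (x + y) = star x + star y"
    and star_scaleC: "star (c *\<^sub>C x) = cnj c *\<^sub>C star x"
    and star_mult: "star (x * y) = star y * star x"
    and cstar_identity: "norm (star x * x) = (norm x)\<^sup>2"

definition spectrum :: "'a::unital_cstar_algebra \<Rightarrow> complex set" where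
  "spectrum a = {c. \<not> (\<exists>b. (a - c *\<^sub>C 1) * b = 1 \<and> b * (a - c *\<^sub>C 1) = 1)}"

definition positive :: "'a::unital_cstar_algebra \<Rightarrow> bool" where
  "positive a \<longleftrightarrow> star a = a \<and> spectrum a \<subseteq> complex_of_real ` {0..}"

section \<open>Hilbert modules\<close>

text \<open>The norm and the completeness of the module are those of the type class \<^class>\<open>banach\<close>,
  tied to the inner product by \<open>norm_eq_sqrt_norm_ip\<close>.\<close>

locale hilbert_module =
  fixes act :: "'v::{complex_vector, banach} \<Rightarrow> 'a::unital_cstar_algebra \<Rightarrow> 'v"
    and ip :: "'v \<Rightarrow> 'v \<Rightarrow> 'a"
  assumes act_add_left: "act (x + y) a = act x a + act y a"
    and act_add_right: "act x (a + b) = act x a + act x b"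
    and act_act: "act (act x a) b = act x (a * b)"
    and act_one: "act x 1 = x"
    and act_scaleC_left: "act (c *\<^sub>C x) a = c *\<^sub>C act x a"
    and act_scaleC_right: "act x (c *\<^sub>C a) = c *\<^sub>C act x a"
    and ip_add_right: "ip x (y + z) = ip x y + ip x z"
    and ip_scaleC_right: "ip x (c *\<^sub>C y) = c *\<^sub>C ip x y"
    and ip_act_right: "ip x (act y a) = ip x y * a"
    and ip_star: "ip y x = star (ip x y)"
    and ip_positive: "positive (ip x x)"
    and ip_definite: "ip x x = 0 \<Longrightarrow> x = 0"
    and norm_eq_sqrt_norm_ip: "norm x = sqrt (norm (ip x x))"

definition countably_generated ::
    "('v::{complex_vector, banach} \<Rightarrow> 'a::unital_cstar_algebra \<Rightarrow> 'v) \<Rightarrow> bool" where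
  "countably_generated act \<longleftrightarrow>
    (\<exists>s :: nat \<Rightarrow> 'v. closure {\<Sum>i<n. act (s i) (a i) | (n :: nat) (a :: nat \<Rightarrow> 'a). True} = UNIV)"

definition dual_module ::
    "('v::{complex_vector, banach} \<Rightarrow> 'a::unital_cstar_algebra \<Rightarrow> 'v) \<Rightarrow> ('v \<Rightarrow> 'a) set" where
  "dual_module act = {f. bounded_linear f \<and> (\<forall>c x. f (c *\<^sub>C x) = c *\<^sub>C f x) \<and>
    (\<forall>x a. f (act x a) = f x * a)}"

definition self_dual ::
    "('v::{complex_vector, banach} \<Rightarrow> 'a::unital_cstar_algebra \<Rightarrow> 'v) \<Rightarrow> ('v \<Rightarrow> 'v \<Rightarrow> 'a) \<Rightarrow> bool"
  where "self_dual act ip \<longleftrightarrow> (\<forall>f\<in>dual_module act. \<exists>x. f = (\<lambda>y. ip x y))"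

text \<open>The locally convex topology generated by a family \<open>P\<close> of seminorms; the open semiballs form a
  subbase. The whole space is added so that it is also the underlying set when \<open>P\<close> is empty.\<close>

definition seminorm_topology :: "('v::real_vector \<Rightarrow> real) set \<Rightarrow> 'v topology" where
  "seminorm_topology P =
    topology_generated_by (insert UNIV {{y. p (y - x) < r} | p x r. p \<in> P \<and> 0 < r})"

definition tau_dual ::
    "('v::{complex_vector, banach} \<Rightarrow> 'a::unital_cstar_algebra \<Rightarrow> 'v) \<Rightarrow> 'v topology" where
  "tau_dual act = seminorm_topology {\<lambda>x. norm (f x) | f. f \<in> dual_module act}"

definition tau_hat ::
    "('v::{complex_vector, banach} \<Rightarrow> 'v \<Rightarrow> 'a::unital_cstar_algebra) \<Rightarrow> 'v topology" where
  "tau_hat ip = seminorm_topology {\<lambda>x. norm (ip z x) | z. True}"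

end

theory Submission
  imports Defs
begin

text \<open>Coincidence of the topologies bounds \<open>f\<close> in the dual by finitely many seminorms
  \<open>x \<mapsto> \<parallel>\<langle>z, x\<rangle>\<parallel>\<close>, \<open>z \<in> F\<close>. There is an adjointable contraction \<open>P\<close> such that \<open>1 - P\<close> has
  finite rank and \<open>P z\<close> is small for \<open>z \<in> F\<close>. Then \<open>f - f P\<^sup>*\<close> is an inner functional, and
  \<open>\<langle>z, P\<^sup>* x\<rangle> = \<langle>P z, x\<rangle>\<close> shows that \<open>f P\<^sup>*\<close> is small in norm. So \<open>f\<close> is a norm limit of
  inner functionals, hence inner by completeness.

  For a single \<open>z\<close>, \<open>P\<close> is an average of powers of a unitary Cayley transform of
  \<open>x \<mapsto> z \<langle>z, x\<rangle>\<close>; since \<open>P\<close> is a contraction, several \<open>z\<close> can be treated one after the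
  other.\<close>

section \<open>Involution and norm in a unital C*-algebra\<close>

lemma scaleC_zero_left [simp]: "0 *\<^sub>C (x::'a::complex_vector) = 0"
  using scaleC_add_left[of 0 0 x] by simp

lemma scaleC_minus_left: "(- c) *\<^sub>C (x::'a::complex_vector) = - (c *\<^sub>C x)"
  using scaleC_add_left[of "-c" c x] by (simp add: eq_neg_iff_add_eq_0)

lemma star_zero [simp]: "star (0::'a::unital_cstar_algebra) = 0"
  using star_add[of 0 "0::'a"] by simp

lemma star_minus: "star (- x) = - star (x::'a::unital_cstar_algebra)"
  using star_add[of "-x" x] by (simp add: eq_neg_iff_add_eq_0)

lemma star_diff: "star (x - y) = star x - star (y::'a::unital_cstar_algebra)"
  using star_add[of x "-y"] by (simp add: star_minus)

lemma star_scaleR: "star (r *\<^sub>R x) = r *\<^sub>R star (x::'a::unital_cstar_algebra)"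
  by (simp add: scaleR_scaleC star_scaleC)

lemma star_one [simp]: "star (1::'a::unital_cstar_algebra) = 1"
  by (metis mult_1 star_mult star_star)

text \<open>The C*-identity and submultiplicativity give one inequality for every element; applied
  to \<open>star x\<close> it becomes the reverse one.\<close>

lemma norm_star [simp]: "norm (star x) = norm (x::'a::unital_cstar_algebra)"
proof -
  have le: "norm y \<le> norm (star y)" for y :: 'a
  proof (cases "y = 0")
    case False
    have "norm y * norm y \<le> norm (star y) * norm y"
      using norm_mult_ineq[of "star y" y] by (simp add: cstar_identity power2_eq_square)
    with False show ?thesis by simp
  qed simp
  show ?thesis using le[of x] le[of "star x"] by (simp add: star_star)
qed

text \<open>By the C*-identity \<open>norm 1\<close> equals its own square, so it is 0 or 1; the
  value 0 belongs to the zero algebra.\<close>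

lemma norm_one_le: "norm (1::'a::unital_cstar_algebra) \<le> 1"
  using cstar_identity[of "1::'a"] by (auto simp: power2_eq_square)

lemma norm_isometry_mult:
  fixes v x :: "'a::unital_cstar_algebra"
  assumes "star v * v = 1"
  shows "norm (v * x) = norm x"
proof -
  have "star (v * x) * (v * x) = star x * (star v * v) * x"
    by (simp add: star_mult mult.assoc)
  then have "(norm (v * x))\<^sup>2 = (norm x)\<^sup>2"
    using assms by (simp flip: cstar_identity)
  then show ?thesis by simp
qed

lemma norm_isometry_power:
  fixes v :: "'a::unital_cstar_algebra"
  assumes "star v * v = 1"
  shows "norm (v ^ n) \<le> 1"
  by (induction n) (simp_all add: norm_one_le norm_isometry_mult[OF assms])

section \<open>Neumann series and the Cayley transform\<close>

lemma neumann_inverse: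
  fixes t :: "'a::unital_cstar_algebra"
  assumes "norm t < 1"
  obtains e where "(1 - t) * e = 1" "e * (1 - t) = 1"
proof -
  have le: "norm (t ^ n) \<le> norm t ^ n" for n
  proof (induction n)
    case (Suc n)
    then show ?case
      using norm_mult_ineq[of t "t ^ n"] mult_left_mono[OF Suc norm_ge_zero[of t]] by simp
  qed (simp add: norm_one_le)
  have sm: "summable (\<lambda>n. t ^ n)"
    using assms by (intro summable_comparison_test'[OF summable_geometric le]) simp
  define e where "e = (\<Sum>n. t ^ n)"
  have split: "e = 1 + (\<Sum>n. t ^ Suc n)"
    using suminf_split_head[OF sm] by (simp add: e_def)
  have "(\<Sum>n. t ^ Suc n) = t * e"
    using bounded_linear.suminf[OF bounded_linear_mult_right sm, of t] by (simp add: e_def)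
  moreover have "(\<Sum>n. t ^ Suc n) = e * t"
    using bounded_linear.suminf[OF bounded_linear_mult_left sm, of t]
    by (simp add: e_def power_commutes)
  ultimately have "(1 - t) * e = 1" "e * (1 - t) = 1"
    using split by (simp_all add: left_diff_distrib right_diff_distrib)
  then show ?thesis by (rule that)
qed

text \<open>Here \<open>d = a + i s\<close> and \<open>c = 2 d\<^sup>-\<^sup>1\<close>, so that \<open>1 - c a\<close> is a Cayley transform of \<open>a\<close>.\<close>

lemma cayley_exists:
  fixes a :: "'a::unital_cstar_algebra"
  assumes "star a = a"
  obtains c d where "c * a = a * c" "d * c = 2 *\<^sub>R 1" "c + star c = star c * a * c"
proof -
  \<comment> \<open>This size of \<open>s\<close> makes \<open>norm t < 1\<close>, so
    \<open>d\<close>, which equals \<open>1 - t\<close> up to the scalar \<open>\<i> * s\<close>, is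
    inverted by a Neumann series.\<close>
  define s where "s = norm a + 1"
  have s: "s > 0" by (simp add: s_def add_nonneg_pos)
  define t where "t = (\<i> / s) *\<^sub>C a"
  have "norm t < 1"
    using s by (simp add: t_def norm_scaleC norm_divide) (simp add: s_def)
  then obtain e where e: "(1 - t) * e = 1" "e * (1 - t) = 1" by (rule neumann_inverse)
  define d where "d = a + (\<i> * s) *\<^sub>C 1"
  define c where "c = (2 / (\<i> * s)) *\<^sub>C e"
  have sc: "scaleC k (x - y) = scaleC k x - scaleC k y" for k and x y :: 'a
    using scaleC_add_right[of k "x - y" y] by (simp add: algebra_simps)
  have d_eq: "d = (\<i> * s) *\<^sub>C (1 - t)"
    using s by (simp add: d_def t_def sc scaleC_scaleC scaleC_minus_left scaleC_one)
  have two: "2 *\<^sub>C x = 2 *\<^sub>R x" for x :: 'a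
    by (simp add: scaleR_scaleC)
  have dc: "d * c = 2 *\<^sub>R 1" and cd: "c * d = 2 *\<^sub>R 1"
    using s by (simp_all add: d_eq c_def mult_scaleC_left mult_scaleC_right scaleC_scaleC e two)
  have "c * d = d * c" using dc cd by simp
  then have comm: "c * a = a * c"
    by (simp add: d_def distrib_left distrib_right mult_scaleC_left mult_scaleC_right)
  have "star d = a - (\<i> * s) *\<^sub>C 1"
    by (simp add: d_def star_add star_scaleC assms scaleC_minus_left)
  then have dd: "d + star d = 2 *\<^sub>R a"
    by (simp add: d_def scaleR_2)
  have cd': "star c * star d = 2 *\<^sub>R 1"
    using arg_cong[OF dc, of star] by (simp add: star_mult star_scaleR)
  \<comment> \<open>With \<open>2 *\<^sub>R a\<close> written as \<open>d + star d\<close>, the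
    first summand cancels against \<open>c\<close> on its right and the second against
    \<open>star c\<close> on its left.\<close>
  have "2 *\<^sub>R (star c * a * c) = star c * (2 *\<^sub>R a) * c" by simp
  also have "\<dots> = star c * (d * c) + (star c * star d) * c"
    by (simp add: dd[symmetric] distrib_left distrib_right mult.assoc)
  also have "\<dots> = 2 *\<^sub>R (c + star c)"
    by (simp add: dc cd' scaleR_add_right)
  finally have "c + star c = star c * a * c" by simp
  with comm dc show ?thesis by (rule that)
qed

text \<open>Multiplying the third assumption by \<open>a\<close> on the left shows that the
  quadratic term of the expanded product cancels the two linear ones.\<close>

lemma cayley_isometry:
  fixes a c :: "'a::unital_cstar_algebra"
  assumes "star a = a" "c * a = a * c" "c + star c = star c * a * c"
  shows "star (1 - c * a) * (1 - c * a) = 1"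
proof -
  have "a * star c * (c * a) = a * (star c * a * c)"
    by (simp add: assms(2) mult.assoc)
  also have "\<dots> = c * a + a * star c"
    by (simp add: assms(2) distrib_left flip: assms(3))
  finally show ?thesis
    by (simp add: star_diff star_mult assms(1) left_diff_distrib right_diff_distrib)
qed

lemma telescope_power:
  fixes v :: "'a::unital_cstar_algebra"
  shows "(1 - v) * (\<Sum>k<n. v ^ k) = 1 - v ^ n"
  by (induction n) (simp_all add: distrib_left left_diff_distrib)

section \<open>Inner product calculus and a Cauchy--Schwarz estimate\<close>

context hilbert_module
begin

lemma ip_zero_right [simp]: "ip x 0 = 0"
  using ip_add_right[of x 0 0] by simp

lemma ip_zero_left [simp]: "ip 0 x = 0"
  by (metis ip_star ip_zero_right star_zero)

lemma ip_minus_right: "ip x (- y) = - ip x y"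
  using ip_add_right[of x "- y" y] by (simp add: eq_neg_iff_add_eq_0)

lemma ip_diff_right: "ip x (y - z) = ip x y - ip x z"
  using ip_add_right[of x y "- z"] by (simp add: ip_minus_right)

lemma ip_scaleR_right: "ip x (r *\<^sub>R y) = r *\<^sub>R ip x y"
  by (simp add: scaleR_scaleC ip_scaleC_right)

lemma ip_add_left: "ip (x + y) z = ip x z + ip y z"
  by (metis ip_add_right ip_star star_add)

lemma ip_diff_left: "ip (x - y) z = ip x z - ip y z"
  by (metis ip_diff_right ip_star star_diff)

lemma ip_scaleR_left: "ip (r *\<^sub>R x) y = r *\<^sub>R ip x y"
  by (metis ip_scaleR_right ip_star star_scaleR)

lemma ip_act_left: "ip (act x a) y = star a * ip x y"
  by (metis ip_act_right ip_star star_mult)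

lemma ip_sum_left: "ip (\<Sum>i\<in>I. g i) y = (\<Sum>i\<in>I. ip (g i) y)"
  by (induction I rule: infinite_finite_induct) (simp_all add: ip_add_left)

lemma ip_sum_right: "ip y (\<Sum>i\<in>I. g i) = (\<Sum>i\<in>I. ip y (g i))"
  by (induction I rule: infinite_finite_induct) (simp_all add: ip_add_right)

lemma star_ip_self: "star (ip x x) = ip x x"
  by (simp flip: ip_star)

lemma norm_ip_self: "norm (ip x x) = (norm x)\<^sup>2"
  by (simp add: norm_eq_sqrt_norm_ip)

lemma act_zero_right [simp]: "act x 0 = 0"
  using act_add_right[of x 0 0] by simp

lemma act_diff_right: "act x (a - b) = act x a - act x b"
  using act_add_right[of x "a - b" b] by (simp add: algebra_simps)

lemma act_sum_right: "act x (\<Sum>i\<in>I. g i) = (\<Sum>i\<in>I. act x (g i))"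
  by (induction I rule: infinite_finite_induct) (simp_all add: act_add_right)

lemma norm_act_le: "norm (act x a) \<le> norm x * norm a"
proof -
  have "(norm (act x a))\<^sup>2 = norm (star a * ip x x * a)"
    by (simp add: ip_act_left ip_act_right mult.assoc flip: norm_ip_self)
  also have "\<dots> \<le> norm (star a * ip x x) * norm a" by (rule norm_mult_ineq)
  also have "\<dots> \<le> norm (star a) * norm (ip x x) * norm a"
    by (intro mult_right_mono norm_mult_ineq) simp
  also have "\<dots> = (norm x * norm a)\<^sup>2"
    by (simp add: norm_ip_self power2_eq_square)
  finally show ?thesis by (rule power2_le_imp_le) simp
qed

text \<open>The constant 3 instead of the 1 of Cauchy--Schwarz comes from using only the triangle
  inequality for the norm of \<open>x + y u\<close>, with \<open>u\<close> chosen such that \<open>ip x (y u)\<close> is self-adjoint.\<close>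

lemma norm_ip_le_unit:
  assumes "norm x \<le> 1" "norm y \<le> 1"
  shows "norm (ip x y) \<le> 3"
proof (cases "ip x y = 0")
  case False
  define b where "b = norm (ip x y)"
  \<comment> \<open>The factor \<open>1 / b\<close> gives the right multiplier norm 1, so
    \<open>w\<close> stays in the unit ball; by the C*-identity \<open>ip x w\<close> has norm
    \<open>b\<close>.\<close>
  define w where "w = act y ((1 / b) *\<^sub>R star (ip x y))"
  have b: "b > 0" using False by (simp add: b_def)
  have "norm w \<le> norm y * norm ((1 / b) *\<^sub>R star (ip x y))"
    unfolding w_def by (rule norm_act_le)
  also have "\<dots> = norm y" using b by (simp add: b_def)
  finally have w: "norm w \<le> 1" using assms by simp
  have xw: "ip x w = (1 / b) *\<^sub>R (ip x y * star (ip x y))"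
    by (simp add: w_def ip_act_right)
  have "ip w x = star (ip x w)" by (rule ip_star)
  then have wx: "ip w x = ip x w"
    by (simp add: xw star_scaleR star_mult star_star)
  have "2 *\<^sub>R ip x w = ip (x + w) (x + w) - ip x x - ip w w"
    by (simp add: ip_add_left ip_add_right wx scaleR_2)
  then have "2 * norm (ip x w) = norm (ip (x + w) (x + w) - ip x x - ip w w)"
    by (metis norm_scaleR abs_numeral)
  also have "\<dots> \<le> norm (ip (x + w) (x + w)) + norm (ip x x) + norm (ip w w)"
    by (intro order.trans[OF norm_triangle_ineq4] add_mono) auto
  also have "\<dots> \<le> 2\<^sup>2 + 1\<^sup>2 + 1\<^sup>2"
    unfolding norm_ip_self using assms w norm_triangle_ineq[of x w]
    by (intro add_mono power_mono) auto
  finally have "norm (ip x w) \<le> 3" by simp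
  moreover have "norm (ip x w) = b"
    using b cstar_identity[of "star (ip x y)"]
    by (simp add: xw star_star b_def power2_eq_square)
  ultimately show ?thesis by (simp add: b_def)
qed simp

lemma norm_ip_le: "norm (ip x y) \<le> 3 * norm x * norm y"
proof (cases "x = 0 \<or> y = 0")
  case False
  have "norm (ip ((1 / norm x) *\<^sub>R x) ((1 / norm y) *\<^sub>R y)) \<le> 3"
    using False by (intro norm_ip_le_unit) auto
  then show ?thesis
    using False by (simp add: ip_scaleR_left ip_scaleR_right field_simps)
qed auto

section \<open>Contractions that change \<open>f\<close> by an inner functional\<close>

text \<open>Only this consequence of \<open>1 - P\<close> having finite rank is used; \<open>Q\<close> is the adjoint of \<open>P\<close>.\<close>

definition corank_contraction :: "('v \<Rightarrow> 'a) \<Rightarrow> ('v \<Rightarrow> 'v) \<Rightarrow> bool" where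
  "corank_contraction f P \<longleftrightarrow> (\<forall>x. norm (P x) \<le> norm x) \<and>
    (\<exists>Q y. (\<forall>x w. ip (P w) x = ip w (Q x)) \<and> (\<forall>x. f x - f (Q x) = ip y x))"

lemma corank_contraction_id: "corank_contraction f (\<lambda>x. x)"
  unfolding corank_contraction_def
  by (auto intro!: exI[of _ "\<lambda>x. x"] exI[of _ 0])

text \<open>The adjoint is \<open>Q\<close> after \<open>Q'\<close>. Split
  \<open>f x - f (Q (Q' x))\<close> at \<open>f (Q' x)\<close>: one part is \<open>ip y' x\<close>,
  the other is \<open>ip y (Q' x)\<close>, that is \<open>ip (P' y) x\<close>.\<close>

lemma corank_contraction_comp:
  assumes "corank_contraction f P" "corank_contraction f P'"
  shows "corank_contraction f (\<lambda>x. P' (P x))"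
proof -
  from assms obtain Q y Q' y'
    where Q: "\<And>x w. ip (P w) x = ip w (Q x)" "\<And>x. f x - f (Q x) = ip y x"
      and Q': "\<And>x w. ip (P' w) x = ip w (Q' x)" "\<And>x. f x - f (Q' x) = ip y' x"
    unfolding corank_contraction_def by metis
  have "f x - f (Q (Q' x)) = ip (y' + P' y) x" for x
    using Q(2)[of "Q' x"] Q'(2)[of x] by (simp add: ip_add_left Q' algebra_simps)
  moreover have "norm (P' (P x)) \<le> norm x" for x
    using assms unfolding corank_contraction_def by (meson order.trans)
  ultimately show ?thesis
    unfolding corank_contraction_def using Q(1) Q'(1)
    by (intro conjI allI exI[of _ "\<lambda>x. Q (Q' x)"] exI[of _ "y' + P' y"]) auto
qed

lemma corank_contraction_funpow:
  assumes "corank_contraction f P"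
  shows "corank_contraction f (P ^^ n)"
proof (induction n)
  case 0
  then show ?case using corank_contraction_id by (simp add: id_def)
next
  case (Suc n)
  then show ?case using corank_contraction_comp[OF Suc assms] by (simp add: o_def)
qed

text \<open>All conditions pass to convex combinations, with the averaged adjoints and vectors as
  witnesses.\<close>

lemma corank_contraction_average:
  fixes P :: "nat \<Rightarrow> 'v \<Rightarrow> 'v"
  assumes f: "linear f" and P: "\<And>k. corank_contraction f (P k)" and n: "n > 0"
  shows "corank_contraction f (\<lambda>x. (1 / n) *\<^sub>R (\<Sum>k<n. P k x))"
proof -
  from P obtain Q y
    where Q: "\<And>k x w. ip (P k w) x = ip w (Q k x)" "\<And>k x. f x - f (Q k x) = ip (y k) x"
    unfolding corank_contraction_def by metis
  have le: "norm ((1 / n) *\<^sub>R (\<Sum>k<n. P k x)) \<le> norm x" for x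
  proof -
    have "norm (\<Sum>k<n. P k x) \<le> (\<Sum>k<n. norm x)"
      using P unfolding corank_contraction_def by (intro sum_norm_le) auto
    then show ?thesis using n by (simp add: field_simps)
  qed
  have "f x - f ((1 / n) *\<^sub>R (\<Sum>k<n. Q k x)) = ip ((1 / n) *\<^sub>R (\<Sum>k<n. y k)) x" for x
  proof -
    have "ip ((1 / n) *\<^sub>R (\<Sum>k<n. y k)) x = (1 / n) *\<^sub>R (\<Sum>k<n. f x - f (Q k x))"
      by (simp add: ip_scaleR_left ip_sum_left Q)
    also have "\<dots> = f x - f ((1 / n) *\<^sub>R (\<Sum>k<n. Q k x))"
      using n by (simp add: sum_subtractf linear_cmul[OF f] linear_sum[OF f] scaleR_diff_right
          sum_constant_scaleR)
    finally show ?thesis by simp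
  qed
  moreover have "ip ((1 / n) *\<^sub>R (\<Sum>k<n. P k w)) x = ip w ((1 / n) *\<^sub>R (\<Sum>k<n. Q k x))" for x w
    by (simp add: ip_scaleR_left ip_scaleR_right ip_sum_left ip_sum_right Q)
  ultimately show ?thesis
    unfolding corank_contraction_def using le
    by (intro conjI allI exI[of _ "\<lambda>x. (1 / n) *\<^sub>R (\<Sum>k<n. Q k x)"]
        exI[of _ "(1 / n) *\<^sub>R (\<Sum>k<n. y k)"]) auto
qed

lemma dual_linear: "f \<in> dual_module act \<Longrightarrow> linear f"
  by (simp add: dual_module_def bounded_linear.linear)

lemma dual_act: "f \<in> dual_module act \<Longrightarrow> f (act x a) = f x * a"
  by (simp add: dual_module_def)

text \<open>The relation for \<open>c\<close> cancels all terms in \<open>z\<close> when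
  \<open>ip (?u x) (?u x)\<close> is expanded, so \<open>?u\<close> is even isometric. Linearity
  over the algebra turns the change of \<open>f\<close> into \<open>f z * star c * ip z x\<close>,
  which is inner.\<close>

lemma corank_contraction_rank_one:
  assumes f: "f \<in> dual_module act" and c: "c + star c = star c * ip z z * c"
  shows "corank_contraction f (\<lambda>x. x - act z (c * ip z x))" (is "corank_contraction f ?u")
proof -
  have zs: "ip x z = star (ip z x)" for x by (rule ip_star)
  have "norm (?u x) = norm x" for x
  proof -
    have "ip (?u x) (?u x) = ip x x - star (ip z x) * (c + star c - star c * ip z z * c) * ip z x"
      by (simp add: ip_diff_left ip_diff_right ip_act_left ip_act_right star_mult zs[of x]
          left_diff_distrib right_diff_distrib distrib_left distrib_right mult.assoc)
    then have "ip (?u x) (?u x) = ip x x" using c by simp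
    then show ?thesis by (simp add: norm_eq_sqrt_norm_ip)
  qed
  moreover have "ip (?u w) x = ip w (x - act z (star c * ip z x))" for x w
    by (simp add: ip_diff_left ip_diff_right ip_act_left ip_act_right star_mult zs[of w] mult.assoc)
  moreover have "f x - f (x - act z (star c * ip z x)) = ip (act z (c * star (f z))) x" for x
    by (simp add: linear_diff[OF dual_linear[OF f]] dual_act[OF f] ip_act_left star_mult star_star
        mult.assoc)
  ultimately show ?thesis
    unfolding corank_contraction_def
    by (intro conjI allI exI[of _ "\<lambda>x. x - act z (star c * ip z x)"]
        exI[of _ "act z (c * star (f z))"]) auto
qed

text \<open>Averages of the powers of \<open>u\<close> work, in the spirit of the mean ergodic theorem:
  \<open>u\<close> moves \<open>z\<close> by right multiplication with a unitary \<open>v\<close>, and \<open>\<langle>z, z\<rangle>\<close> is a multiple of \<open>1 - v\<close>.\<close>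

lemma corank_contraction_small_at:
  assumes f: "f \<in> dual_module act" and e: "\<epsilon> > 0"
  obtains P where "corank_contraction f P" "norm (P z) < \<epsilon>"
proof -
  define a where "a = ip z z"
  have a: "star a = a" by (simp add: a_def star_ip_self)
  obtain c d where c: "c * a = a * c" "d * c = 2 *\<^sub>R 1" "c + star c = star c * a * c"
    using cayley_exists[OF a] by blast
  define v where "v = 1 - c * a"
  have vv: "star v * v = 1" using cayley_isometry[OF a c(1,3)] by (simp add: v_def)
  define u where "u = (\<lambda>x. x - act z (c * ip z x))"
  have u: "corank_contraction f u"
    unfolding u_def using f c(3) by (intro corank_contraction_rank_one) (simp_all add: a_def)
  have pow: "(u ^^ k) z = act z (v ^ k)" for k
  proof (induction k)
    case (Suc k)
    then show ?case
      by (simp add: u_def ip_act_right v_def a_def left_diff_distrib act_diff_right mult.assoc)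
  qed (simp add: act_one)
  \<comment> \<open>The final estimate is
    \<open>(norm (P z))\<^sup>2 \<le> norm d / n\<close>.\<close>
  obtain n :: nat where n: "norm d / \<epsilon>\<^sup>2 < n" using reals_Archimedean2 by blast
  have n0: "n > 0"
    using n e by (cases n) (auto simp: divide_less_0_iff not_less)
  define s where "s = (\<Sum>k<n. v ^ k)"
  define P where "P = (\<lambda>x. (1 / n) *\<^sub>R (\<Sum>k<n. (u ^^ k) x))"
  have Pz: "P z = (1 / n) *\<^sub>R act z s"
    by (simp add: P_def pow s_def act_sum_right)
  have s: "norm s \<le> n"
    using sum_norm_le[of "{..<n}" "\<lambda>k. v ^ k" "\<lambda>_. 1"] norm_isometry_power[OF vv]
    by (simp add: s_def)
  \<comment> \<open>Since \<open>d * c\<close> is twice the unit, \<open>a\<close> is half of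
    \<open>d * (1 - v)\<close>. The sum then telescopes, and \<open>a * s\<close> is bounded
    independently of \<open>n\<close>.\<close>
  have "2 *\<^sub>R (a * s) = d * ((1 - v) * s)"
    using c(2) by (simp add: v_def flip: mult.assoc)
  also have "\<dots> = d * (1 - v ^ n)" by (simp add: s_def telescope_power)
  finally have "2 * norm (a * s) = norm (d * (1 - v ^ n))"
    by (metis norm_scaleR abs_numeral)
  also have "\<dots> \<le> norm d * 2"
    using norm_triangle_ineq4[of 1 "v ^ n"] norm_isometry_power[OF vv, of n]
      norm_one_le[where 'a='a]
    by (intro order.trans[OF norm_mult_ineq] mult_left_mono) auto
  finally have as: "norm (a * s) \<le> norm d" by simp
  \<comment> \<open>Only the factor \<open>star s\<close> grows with \<open>n\<close>, and at most
    linearly, whereas the average divides the square by \<open>n\<^sup>2\<close>.\<close>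
  have "(norm (act z s))\<^sup>2 = norm (star s * (a * s))"
    by (simp add: ip_act_left ip_act_right a_def mult.assoc flip: norm_ip_self)
  also have "\<dots> \<le> norm (star s) * norm (a * s)" by (rule norm_mult_ineq)
  also have "\<dots> \<le> n * norm d" using s as by (intro mult_mono) auto
  also have "\<dots> < n * (n * \<epsilon>\<^sup>2)" using n n0 e by (simp add: field_simps)
  finally have "(norm (P z))\<^sup>2 < \<epsilon>\<^sup>2"
    using n0 by (simp add: Pz field_simps power2_eq_square)
  then have "norm (P z) < \<epsilon>" using e by (simp add: power2_less_imp_less)
  moreover have "corank_contraction f P"
    unfolding P_def
    using corank_contraction_average[OF dual_linear[OF f] corank_contraction_funpow[OF u] n0] .
  ultimately show ?thesis using that by blast
qed

lemma corank_contraction_small_on_finite: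
  assumes f: "f \<in> dual_module act" and e: "\<epsilon> > 0" and F: "finite F"
  shows "\<exists>P. corank_contraction f P \<and> (\<forall>z\<in>F. norm (P z) < \<epsilon>)"
  using F
proof induction
  case empty
  then show ?case using corank_contraction_id by blast
next
  case (insert z F)
  then obtain P where P: "corank_contraction f P" "\<forall>z\<in>F. norm (P z) < \<epsilon>" by blast
  \<comment> \<open>Smallness is requested at \<open>P z\<close>, not at \<open>z\<close>, because
    \<open>P'\<close> is applied after \<open>P\<close>.\<close>
  obtain P' where P': "corank_contraction f P'" "norm (P' (P z)) < \<epsilon>"
    using corank_contraction_small_at[OF f e] by blast
  have "norm (P' (P w)) < \<epsilon>" if "w \<in> F" for w
    using P(2) P'(1) that unfolding corank_contraction_def by (meson le_less_trans)
  then show ?case using corank_contraction_comp[OF P(1) P'(1)] P'(2) by blast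
qed

section \<open>Norm limits of inner functionals\<close>

lemma norm_ip_bound_imp_norm_le:
  assumes "\<And>x. norm (ip y x) \<le> K * norm x" "K \<ge> 0"
  shows "norm y \<le> K"
proof (cases "y = 0")
  case False
  have "norm y * norm y \<le> K * norm y"
    using assms(1)[of y] by (simp add: norm_ip_self power2_eq_square)
  with False show ?thesis by simp
qed (simp add: assms)

text \<open>A vector is bounded in norm by its inner functional, so vectors representing ever better
  approximations form a Cauchy sequence; its limit represents \<open>f\<close>.\<close>

lemma inner_if_approximable:
  assumes "\<And>\<eta>. \<eta> > 0 \<Longrightarrow> \<exists>y. \<forall>x. norm (f x - ip y x) \<le> \<eta> * norm x"
  shows "\<exists>y. f = (\<lambda>x. ip y x)"
proof -
  define r where "r n = 1 / real (Suc n)" for n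
  have r: "r n > 0" for n by (simp add: r_def)
  have r0: "r \<longlonglongrightarrow> 0"
    unfolding r_def using lim_inverse_n' LIMSEQ_Suc by blast
  obtain y where y: "\<And>n x. norm (f x - ip (y n) x) \<le> r n * norm x"
    using assms[OF r] by metis
  have dy: "norm (y m - y n) \<le> r m + r n" for m n
  proof (rule norm_ip_bound_imp_norm_le)
    fix x
    have "ip (y m - y n) x = (f x - ip (y n) x) - (f x - ip (y m) x)"
      by (simp add: ip_diff_left)
    also have "norm \<dots> \<le> (r m + r n) * norm x"
      using norm_triangle_ineq4[of "f x - ip (y n) x" "f x - ip (y m) x"] y[of x m] y[of x n]
      by (simp add: algebra_simps)
    finally show "norm (ip (y m - y n) x) \<le> (r m + r n) * norm x" .
  qed (use r[of m] r[of n] in simp)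
  have "Cauchy y"
  proof (rule metric_CauchyI)
    fix e :: real assume "e > 0"
    then obtain M where M: "\<And>n. n \<ge> M \<Longrightarrow> \<bar>r n\<bar> < e / 2"
      using LIMSEQ_D[OF r0, of "e / 2"] by auto
    have "dist (y m) (y n) < e" if "m \<ge> M" "n \<ge> M" for m n
      using dy[of m n] M[OF that(1)] M[OF that(2)] by (simp add: dist_norm)
    then show "\<exists>M. \<forall>m\<ge>M. \<forall>n\<ge>M. dist (y m) (y n) < e" by blast
  qed
  then obtain l where l: "y \<longlonglongrightarrow> l"
    using Cauchy_convergent_iff convergent_def by blast
  have "f x = ip l x" for x
  proof -
    have "(\<lambda>n. norm (f x - ip l x)) \<longlonglongrightarrow> norm (f x - ip l x)" by simp
    moreover have "(\<lambda>n. r n * norm x + 3 * norm (y n - l) * norm x) \<longlonglongrightarrow> 0 * norm x + 3 * norm (l - l) * norm x"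
      by (intro tendsto_intros r0 l)
    moreover have "norm (f x - ip l x) \<le> r n * norm x + 3 * norm (y n - l) * norm x" for n
    proof -
      have "f x - ip l x = (f x - ip (y n) x) + ip (y n - l) x"
        by (simp add: ip_diff_left)
      then show ?thesis
        by (metis norm_triangle_le add_mono y norm_ip_le)
    qed
    ultimately have "norm (f x - ip l x) \<le> 0 * norm x + 3 * norm (l - l) * norm x"
      by (intro LIMSEQ_le[of "\<lambda>n. norm (f x - ip l x)"]) auto
    then show ?thesis by simp
  qed
  then show ?thesis by blast
qed

section \<open>From the coincidence of the topologies to approximation\<close>

lemma tau_hat_nhd_zero:
  assumes "openin (tau_hat ip) U" "0 \<in> U"
  shows "\<exists>F \<delta>. finite F \<and> \<delta> > 0 \<and> (\<forall>x. (\<forall>z\<in>F. norm (ip z x) < \<delta>) \<longrightarrow> x \<in> U)"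
proof -
  define S where "S = insert UNIV {{y. p (y - x) < r} | p (x::'v) (r::real).
    p \<in> {\<lambda>x. norm (ip z x) | z. True} \<and> 0 < r}"
  have "generate_topology_on S U"
    using assms(1) by (simp add: tau_hat_def seminorm_topology_def S_def
        openin_topology_generated_by_iff)
  then show ?thesis
    using assms(2)
  proof induction
    case Empty
    then show ?case by simp
  next
    case (Int U V)
    then obtain F \<delta> F' \<delta>' where "finite F" "\<delta> > 0" "\<And>x. (\<forall>z\<in>F. norm (ip z x) < \<delta>) \<Longrightarrow> x \<in> U"
      "finite F'" "\<delta>' > 0" "\<And>x. (\<forall>z\<in>F'. norm (ip z x) < \<delta>') \<Longrightarrow> x \<in> V"
      by (metis IntE)
    then show ?case
      by (intro exI[of _ "F \<union> F'"] exI[of _ "min \<delta> \<delta>'"]) auto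
  next
    case (UN K)
    then show ?case by (meson UnionE UnionI)
  next
    case (Basis U)
    show ?case
    proof (cases "U = UNIV")
      case True
      then show ?thesis by (intro exI[of _ "{}"] exI[of _ 1]) auto
    next
      case False
      with Basis obtain z w r where U: "U = {y. norm (ip z (y - w)) < r}"
        unfolding S_def by blast
      \<comment> \<open>A semiball centred at \<open>w\<close> that contains 0 contains a smaller
        one centred at 0, by the triangle inequality.\<close>
      have "norm (ip z (x - w)) < r" if "norm (ip z x) < r - norm (ip z w)" for x
        using norm_triangle_ineq4[of "ip z x" "ip z w"] that by (simp add: ip_diff_right)
      moreover have "norm (ip z w) < r"
        using Basis.prems by (simp add: U ip_minus_right)
      ultimately show ?thesis
        by (intro exI[of _ "{z}"] exI[of _ "r - norm (ip z w)"]) (auto simp: U)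
    qed
  qed
qed

lemma dual_approximable:
  assumes f: "f \<in> dual_module act" and top: "tau_hat ip = tau_dual act" and eta: "\<eta> > 0"
  shows "\<exists>y. \<forall>x. norm (f x - ip y x) \<le> \<eta> * norm x"
proof -
  note lin = dual_linear[OF f]
  have "openin (tau_dual act) {x. norm (f (x - 0)) < 1}"
    unfolding tau_dual_def seminorm_topology_def using f
    by (intro topology_generated_by_Basis insertI2 CollectI exI[of _ "\<lambda>x. norm (f x)"]
        exI[of _ "0::'v"] exI[of _ "1::real"]) auto
  then have "\<exists>F \<delta>. finite F \<and> \<delta> > 0 \<and>
      (\<forall>x. (\<forall>z\<in>F. norm (ip z x) < \<delta>) \<longrightarrow> x \<in> {x. norm (f (x - 0)) < 1})"
    by (intro tau_hat_nhd_zero) (simp_all add: top linear_0[OF lin])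
  then obtain F \<delta> where F: "finite F" and d: "\<delta> > 0"
    and fF: "\<And>x. \<forall>z\<in>F. norm (ip z x) < \<delta> \<Longrightarrow> norm (f x) < 1" by auto
  \<comment> \<open>The divisor 3 absorbs the constant of \<open>norm_ip_le\<close>.\<close>
  obtain P where P: "corank_contraction f P" "\<forall>z\<in>F. norm (P z) < \<eta> * \<delta> / 3"
    using corank_contraction_small_on_finite[OF f _ F, of "\<eta> * \<delta> / 3"] eta d by auto
  then obtain Q y where Q: "\<And>x w. ip (P w) x = ip w (Q x)" "\<And>x. f x - f (Q x) = ip y x"
    unfolding corank_contraction_def by blast
  have "norm (f x - ip y x) \<le> \<eta> * norm x" for x
  proof (cases "x = 0")
    case True
    then show ?thesis by (simp add: linear_0[OF lin])
  next
    case False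
    \<comment> \<open>Scaled by \<open>t\<close>, the vector \<open>Q x\<close> lies in all the
      semiballs given by \<open>F\<close> and \<open>\<delta>\<close>; undoing the scaling turns the
      bound 1 into \<open>\<eta> * norm x\<close>.\<close>
    define t where "t = 1 / (\<eta> * norm x)"
    have t: "t > 0" using False eta by (simp add: t_def)
    have "norm (ip z (t *\<^sub>R Q x)) < \<delta>" if "z \<in> F" for z
    proof -
      have "norm (ip z (t *\<^sub>R Q x)) = t * norm (ip (P z) x)"
        using t by (simp add: ip_scaleR_right Q)
      also have "\<dots> \<le> t * (3 * norm (P z) * norm x)"
        using t norm_ip_le by (intro mult_left_mono) auto
      also have "\<dots> < t * (3 * (\<eta> * \<delta> / 3) * norm x)"
        using t P(2) that False by (simp add: mult.commute)
      also have "\<dots> = \<delta>" using False eta by (simp add: t_def)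
      finally show ?thesis .
    qed
    then have "norm (f (t *\<^sub>R Q x)) < 1" using fF by blast
    then have "norm (f (Q x)) < \<eta> * norm x"
      using t False eta by (simp add: linear_cmul[OF lin] t_def field_simps)
    moreover have "f x - ip y x = f (Q x)" using Q(2)[of x] by (simp add: algebra_simps)
    ultimately show ?thesis by simp
  qed
  then show ?thesis by blast
qed

end

theorem corollary3p8:
  fixes act :: "'v::{complex_vector, banach} \<Rightarrow> 'a::unital_cstar_algebra \<Rightarrow> 'v"
    and ip :: "'v \<Rightarrow> 'v \<Rightarrow> 'a"
  assumes "hilbert_module act ip"
    and "countably_generated act"
    and "tau_hat ip = tau_dual act"
  shows "self_dual act ip"
  unfolding self_dual_def
  using hilbert_module.inner_if_approximable[OF assms(1)]
    hilbert_module.dual_approximable[OF assms(1) _ assms(3)] by blast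

end
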